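(* Let $\mathcal{D}=(\Omega,\mathcal{B})$ be a supersimple $2$-$(n,4,\lambda)$ design satisfying property $(\triangle)$, such that $(\Omega,\mathcal{C})$ is a regular two-graph where $\mathcal{C}$ is the set of collinear triples, and suppose $n>2\lambda+2$. Let $\infty\in\Omega$, $G:=\mathcal{L}_\infty(\mathcal{D})$, and $\mathcal{E}:=\{[a,b]\mid a,b\in\Omega\}$. Then: (a) $(G,\mathcal{E})$ is a $3$-transposition group; (b) $G$ is a $2$-primitive subgroup of $\operatorname{Sym}(\Omega)$; (c) $Z(G)=1$; (d) $\mathcal{E}$ is a conjugacy class in $G$.
   Context: A $2$-$(n,4,\lambda)$ design $(\Omega,\mathcal{B})$: $n$ points, a multiset of $4$-subsets (lines), every $2$-subset in exactly $\lambda$ lines; supersimple: distinct lines meet in at most two points. For distinct $a,b$ with lines $\{a,b,a_i,b_i\}$ through them, $[a,b]:=(a,b)\prod_i(a_i,b_i)$; $[a,a]:=1$. Permutations act on the right, products composed left to right; $[a_0,\dots,a_k]:=[a_0,a_1]\cdots[a_{k-1},a_k]$; $\mathcal{L}_\infty(\mathcal{D})$ = move sequences starting at $\infty$. Property $(\triangle)$: if $B_1,B_2\in\mathcal{B}$ with $|B_1\cap B_2|=2$ then $B_1\triangle B_2\in\mathcal{B}$. Regular two-graph: $(\Omega,\mathcal{C})$ is a $2$-$(n,3,\mu)$ design with every $4$-subset containing $0,2$ or $4$ members of $\mathcal{C}$. A $3$-transposition group: a pair $(G,\mathcal{E})$, $\mathcal{E}$ a set of involutions with $G=\langle\mathcal{E}\rangle$,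 $\mathcal{E}$ a union of $G$-conjugacy classes, $gh$ of order $1,2$ or $3$ for $g,h\in\mathcal{E}$. A permutation group is $2$-primitive if it is transitive and a point stabilizer is primitive on the remaining points.
   Formalization: The set E is taken as {[a,b] | a,b in Ω, a ≠ b}: since [a,a] = 1 is not an involution, allowing a = b would put the identity in E and make (a) and (d) false. *)

theory Defs
  imports Main "HOL-Library.Multiset" "HOL-Combinatorics.Permutations"
begin

definition design_2_4 :: "'a set \<Rightarrow> 'a set multiset \<Rightarrow> nat \<Rightarrow> nat \<Rightarrow> bool" where
  "design_2_4 \<Omega> \<B> n lam \<longleftrightarrow>
     finite \<Omega> \<and> card \<Omega> = n \<and>
     (\<forall>L\<in>#\<B>. L \<subseteq> \<Omega> \<and> card L = 4) \<and>
     (\<forall>x\<in>\<Omega>. \<forall>y\<in>\<Omega>. x \<noteq> y \<longrightarrow> size (filter_mset (\<lambda>L. {x, y} \<subseteq> L) \<B>) = lam)"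

definition supersimple :: "'a set multiset \<Rightarrow> bool" where
  "supersimple \<B> \<longleftrightarrow> (\<forall>X\<in>#\<B>. \<forall>Y\<in>#(\<B> - {#X#}). card (X \<inter> Y) \<le> 2)"

definition prop_triangle :: "'a set multiset \<Rightarrow> bool" where
  "prop_triangle \<B> \<longleftrightarrow>
     (\<forall>B1\<in>#\<B>. \<forall>B2\<in>#\<B>. card (B1 \<inter> B2) = 2 \<longrightarrow> (B1 - B2) \<union> (B2 - B1) \<in># \<B>)"

definition collinear_triples :: "'a set \<Rightarrow> 'a set multiset \<Rightarrow> 'a set set" where
  "collinear_triples \<Omega> \<B> = {T. T \<subseteq> \<Omega> \<and> card T = 3 \<and> (\<exists>L\<in>#\<B>. T \<subseteq> L)}"

definition regular_two_graph :: "'a set \<Rightarrow> 'a set set \<Rightarrow> bool" where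
  "regular_two_graph \<Omega> \<C> \<longleftrightarrow>
     (\<forall>T\<in>\<C>. T \<subseteq> \<Omega> \<and> card T = 3) \<and>
     (\<exists>\<mu>::nat. \<forall>x\<in>\<Omega>. \<forall>y\<in>\<Omega>. x \<noteq> y \<longrightarrow> card {T\<in>\<C>. {x, y} \<subseteq> T} = \<mu>) \<and>
     (\<forall>F. F \<subseteq> \<Omega> \<and> card F = 4 \<longrightarrow> card {T\<in>\<C>. T \<subseteq> F} \<in> {0, 2, 4})"

(* The elementary move [a,b] = (a,b) \<Prod>_i (a_i,b_i) as a map on points (identity off Omega).
   For a supersimple design the pairs {a_i,b_i} are pairwise disjoint, so the product of these
   transpositions is independent of order: it swaps a and b, sends a point x \<notin> {a,b} that lies on
   a line {a,b,x,y} to y, and fixes every other point.  [a,a] = 1. *)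
definition mv :: "'a set multiset \<Rightarrow> 'a \<Rightarrow> 'a \<Rightarrow> 'a \<Rightarrow> 'a" where
  "mv \<B> a b x =
     (if a = b then x
      else if x = a then b
      else if x = b then a
      else if (\<exists>L\<in>#\<B>. {a, b, x} \<subseteq> L) then (THE y. y \<notin> {a, b, x} \<and> (\<exists>L\<in>#\<B>. L = {a, b, x, y}))
      else x)"

(* [a0,a1,...,ak] = [a0,a1][a1,a2]...[a_{k-1},a_k], permutations acting on the right and
   products composed left to right, i.e. as functions: [a_{k-1},a_k] o ... o [a0,a1]. *)
fun mv_seq :: "'a set multiset \<Rightarrow> 'a list \<Rightarrow> 'a \<Rightarrow> 'a" where
  "mv_seq \<B> [] = id"
| "mv_seq \<B> [a] = id"
| "mv_seq \<B> (a # b # rest) = mv_seq \<B> (b # rest) \<circ> mv \<B> a b"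

definition L_infty :: "'a set \<Rightarrow> 'a set multiset \<Rightarrow> 'a \<Rightarrow> ('a \<Rightarrow> 'a) set" where
  "L_infty \<Omega> \<B> pinf = {mv_seq \<B> (pinf # as) | as. set as \<subseteq> \<Omega>}"

definition Sym :: "'a set \<Rightarrow> ('a \<Rightarrow> 'a) set" where
  "Sym \<Omega> = {p. p permutes \<Omega>}"

definition is_subgroup_Sym :: "'a set \<Rightarrow> ('a \<Rightarrow> 'a) set \<Rightarrow> bool" where
  "is_subgroup_Sym \<Omega> G \<longleftrightarrow> G \<subseteq> Sym \<Omega> \<and> id \<in> G \<and>
     (\<forall>g\<in>G. \<forall>h\<in>G. g \<circ> h \<in> G) \<and> (\<forall>g\<in>G. inv g \<in> G)"

inductive_set generated :: "('a \<Rightarrow> 'a) set \<Rightarrow> ('a \<Rightarrow> 'a) set" for E where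
  gen_id: "id \<in> generated E"
| gen_elem: "e \<in> E \<Longrightarrow> e \<in> generated E"
| gen_comp: "g \<in> generated E \<Longrightarrow> h \<in> generated E \<Longrightarrow> g \<circ> h \<in> generated E"
| gen_inv: "g \<in> generated E \<Longrightarrow> inv g \<in> generated E"

definition perm_order :: "('a \<Rightarrow> 'a) \<Rightarrow> nat" where
  "perm_order p = (LEAST k. 0 < k \<and> p ^^ k = id)"

definition three_transposition_group :: "('a \<Rightarrow> 'a) set \<Rightarrow> ('a \<Rightarrow> 'a) set \<Rightarrow> bool" where
  "three_transposition_group G E \<longleftrightarrow>
     (\<forall>e\<in>E. e \<noteq> id \<and> e \<circ> e = id) \<and>
     G = generated E \<and>
     (\<forall>g\<in>G. \<forall>e\<in>E. g \<circ> e \<circ> inv g \<in> E) \<and>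
     (\<forall>g\<in>E. \<forall>h\<in>E. perm_order (g \<circ> h) \<in> {1, 2, 3})"

definition conj_class :: "('a \<Rightarrow> 'a) set \<Rightarrow> ('a \<Rightarrow> 'a) \<Rightarrow> ('a \<Rightarrow> 'a) set" where
  "conj_class G e = {g \<circ> e \<circ> inv g | g. g \<in> G}"

definition centre :: "('a \<Rightarrow> 'a) set \<Rightarrow> ('a \<Rightarrow> 'a) set" where
  "centre G = {z\<in>G. \<forall>g\<in>G. z \<circ> g = g \<circ> z}"

definition transitive_on :: "('a \<Rightarrow> 'a) set \<Rightarrow> 'a set \<Rightarrow> bool" where
  "transitive_on H X \<longleftrightarrow> X \<noteq> {} \<and> (\<forall>x\<in>X. \<forall>y\<in>X. \<exists>h\<in>H. h x = y)"

definition primitive_on :: "('a \<Rightarrow> 'a) set \<Rightarrow> 'a set \<Rightarrow> bool" where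
  "primitive_on H X \<longleftrightarrow> transitive_on H X \<and>
     (\<forall>Y. Y \<subseteq> X \<and> Y \<noteq> {} \<and> (\<forall>h\<in>H. h ` Y = Y \<or> h ` Y \<inter> Y = {})
          \<longrightarrow> card Y = 1 \<or> Y = X)"

definition stabiliser :: "('a \<Rightarrow> 'a) set \<Rightarrow> 'a \<Rightarrow> ('a \<Rightarrow> 'a) set" where
  "stabiliser G x = {g\<in>G. g x = x}"

definition two_primitive :: "('a \<Rightarrow> 'a) set \<Rightarrow> 'a set \<Rightarrow> bool" where
  "two_primitive G \<Omega> \<longleftrightarrow> transitive_on G \<Omega> \<and>
     (\<forall>x\<in>\<Omega>. primitive_on (stabiliser G x) (\<Omega> - {x}))"

end

theory Submission
  imports Defs
begin

text \<open>Property \<open>(\<triangle>)\<close> together with the parity condition of the two-graph makes every move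
  \<open>[a, b]\<close> an automorphism of the design, and \<open>[a, b] = [c, d]\<close> whenever \<open>{a, b, c, d}\<close> is a
  line. Conjugation by a move therefore just relabels moves: two moves commute or braid according
  to whether the first moves an even number or exactly one of the two points defining the second.

  Fix \<open>x\<close> and call \<open>y, z\<close> adjacent if \<open>x, y, z\<close> are collinear. A point off a line through
  \<open>x\<close> is adjacent to one or all of its other three points, and \<open>n > 2\<lambda> + 2\<close> says that no point is
  adjacent to all others; hence the non-adjacency graph is connected. Since \<open>[y, z]\<close> fixes \<open>x\<close>
  for non-adjacent \<open>y, z\<close>, the stabiliser of \<open>x\<close> is transitive on the other points. A block
  containing an adjacent pair is closed under lines and adjacent to everything outside it, so it
  is everything. In a block of at least two points without adjacent pairs, the elements
  \<open>[x, y][y, z][z, x]\<close> for collinear \<open>x, y, z\<close> show that no point has any adjacent point, and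
  the block is again everything. The centre is trivial and the moves form one
  conjugacy class because the group is 2-transitive on at least three points.\<close>

text \<open>The base point is left out: the group turns out not to depend on it, and the arguments
  let every point play its role.\<close>

locale two_graph_design =
  fixes \<Omega> :: "'a set" and \<B> :: "'a set multiset" and n lam :: nat
  assumes design: "design_2_4 \<Omega> \<B> n lam"
    and supersimple: "supersimple \<B>"
    and triangle: "prop_triangle \<B>"
    and two_graph: "regular_two_graph \<Omega> (collinear_triples \<Omega> \<B>)"
    and many_points: "n > 2 * lam + 2"
begin

section \<open>Lines and collinear triples\<close>

definition line :: "'a \<Rightarrow> 'a \<Rightarrow> 'a \<Rightarrow> 'a \<Rightarrow> bool" where
  "line a b c d \<longleftrightarrow> {a, b, c, d} \<in># \<B>"

text \<open>Blocks have four elements, so \<open>col\<close> is false as soon as two of its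
  arguments coincide.\<close>

definition col :: "'a \<Rightarrow> 'a \<Rightarrow> 'a \<Rightarrow> bool" where
  "col a b c \<longleftrightarrow> (\<exists>d. line a b c d)"

lemma finite_points: "finite \<Omega>"
  using design by (simp add: design_2_4_def)

lemma line_block: "L \<in># \<B> \<Longrightarrow> L \<subseteq> \<Omega> \<and> card L = 4"
  using design by (simp add: design_2_4_def)

lemma line_distinct: "line a b c d \<Longrightarrow> distinct [a, b, c, d]"
  using line_block[of "{a, b, c, d}"] unfolding line_def
  by (auto simp: card_insert_if split: if_splits)

lemma line_neq:
  assumes "line a b c d"
  shows "a \<noteq> b" "a \<noteq> c" "a \<noteq> d" "b \<noteq> c" "b \<noteq> d" "c \<noteq> d"
  using line_distinct[OF assms] by auto

lemma line_in_points:
  assumes "line a b c d"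
  shows "a \<in> \<Omega>" "b \<in> \<Omega>" "c \<in> \<Omega>" "d \<in> \<Omega>"
  using line_block[of "{a, b, c, d}"] assms by (auto simp: line_def)

lemma line_swap:
  "line a b c d \<Longrightarrow> line b a c d"
  "line a b c d \<Longrightarrow> line a c b d"
  "line a b c d \<Longrightarrow> line a b d c"
  "line a b c d \<Longrightarrow> line c d a b"
  by (simp_all add: line_def insert_commute)

lemma line_perms:
  assumes "line a b c d" "{a', b', c', d'} = {a, b, c, d}"
  shows "line a' b' c' d'"
  using assms by (simp add: line_def)

lemma blocks_meet: "L \<in># \<B> \<Longrightarrow> M \<in># \<B> \<Longrightarrow> L \<noteq> M \<Longrightarrow> card (L \<inter> M) \<le> 2"
  using supersimple unfolding supersimple_def
  by (metis (no_types, lifting) in_diff_count count_single diff_zero not_in_iff zero_less_iff_neq_zero)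

lemma line_unique:
  assumes "line a b c d" "line a b c e"
  shows "d = e"
proof (rule ccontr)
  assume "d \<noteq> e"
  have neq: "a \<noteq> b" "a \<noteq> c" "b \<noteq> c" "d \<notin> {a, b, c}"
    using line_neq[OF assms(1)] by auto
  then have "{a, b, c, d} \<noteq> {a, b, c, e}" using \<open>d \<noteq> e\<close> by blast
  moreover have "card {a, b, c} \<le> card ({a, b, c, d} \<inter> {a, b, c, e})"
    by (intro card_mono) auto
  moreover have "card {a, b, c} = 3" using neq by simp
  ultimately show False
    using blocks_meet[of "{a, b, c, d}" "{a, b, c, e}"] assms by (simp add: line_def)
qed

text \<open>The working form of property (\<triangle>). It suffices to keep \<open>e\<close> away
  from \<open>c\<close> and \<open>d\<close>: if \<open>f\<close> were one of them, the two lines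
  would share three points and coincide, which would put \<open>e\<close> into {c, d}.\<close>

lemma line_triangle:
  assumes "line a b c d" "line a b e f" "e \<noteq> c" "e \<noteq> d"
  shows "line c d e f"
proof -
  have n1: "a \<noteq> b" "a \<noteq> c" "a \<noteq> d" "b \<noteq> c" "b \<noteq> d" "c \<noteq> d"
    and n2: "a \<noteq> e" "a \<noteq> f" "b \<noteq> e" "b \<noteq> f" "e \<noteq> f"
    using line_neq[OF assms(1)] line_neq[OF assms(2)] by auto
  have "f \<noteq> c" "f \<noteq> d"
    using assms line_unique line_swap by metis+
  then have "{a, b, c, d} \<inter> {a, b, e, f} = {a, b}"
    "({a, b, c, d} - {a, b, e, f}) \<union> ({a, b, e, f} - {a, b, c, d}) = {c, d, e, f}"
    using n1 n2 assms(3,4) by auto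
  then show ?thesis
    using triangle assms(1,2) n1 unfolding prop_triangle_def line_def
    by (metis card_2_iff)
qed

lemma col_swap:
  "col a b c \<longleftrightarrow> col b a c" "col a b c \<longleftrightarrow> col a c b"
  unfolding col_def using line_swap by blast+

lemma line_imp_col:
  assumes "line a b c d"
  shows "col a b c" "col a b d" "col a c d" "col b c d"
  using assms line_swap unfolding col_def by meson+

lemma col_in_points: "col a b c \<Longrightarrow> a \<in> \<Omega> \<and> b \<in> \<Omega> \<and> c \<in> \<Omega>"
  unfolding col_def using line_in_points by blast

lemma block_superset:
  assumes "distinct [a, b, c]" "L \<in># \<B>" "{a, b, c} \<subseteq> L"
  shows "\<exists>d. L = {a, b, c, d} \<and> d \<notin> {a, b, c}"
proof -
  have "card (L - {a, b, c}) = 1"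
    using assms line_block[OF assms(2)] by (subst card_Diff_subset) auto
  then obtain d where "L - {a, b, c} = {d}" by (auto simp: card_1_singleton_iff)
  then show ?thesis using assms(3) by (intro exI[of _ d]) blast
qed

lemma collinear_triples_iff_col:
  assumes "distinct [a, b, c]"
  shows "{a, b, c} \<in> collinear_triples \<Omega> \<B> \<longleftrightarrow> col a b c"
proof
  assume "{a, b, c} \<in> collinear_triples \<Omega> \<B>"
  then obtain L where "L \<in># \<B>" "{a, b, c} \<subseteq> L" by (auto simp: collinear_triples_def)
  then show "col a b c"
    using block_superset[OF assms] by (auto simp: col_def line_def)
next
  assume "col a b c"
  then obtain d where d: "line a b c d" by (auto simp: col_def)
  then show "{a, b, c} \<in> collinear_triples \<Omega> \<B>"
    using assms line_in_points[OF d]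
    by (auto simp: collinear_triples_def line_def intro!: bexI[of _ "{a, b, c, d}"])
qed

section \<open>Parity, counting, and adjacency to the points of a line\<close>

text \<open>Nested equivalences of four truth values hold iff an even number of them are true, which
  is the 0, 2 or 4 of a two-graph.\<close>

lemma col_parity:
  assumes "distinct [a, b, c, d]" "a \<in> \<Omega>" "b \<in> \<Omega>" "c \<in> \<Omega>" "d \<in> \<Omega>"
  shows "(col a b c \<longleftrightarrow> col a b d) \<longleftrightarrow> (col a c d \<longleftrightarrow> col b c d)"
proof -
  let ?C = "collinear_triples \<Omega> \<B>" and ?F = "{a, b, c, d}"
  let ?T = "{{a, b, c}, {a, b, d}, {a, c, d}, {b, c, d}}"
  have F: "card ?F = 4" using assms(1) by simp
  have "T \<in> ?T" if "T \<subseteq> ?F" "card T = 3" for T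
  proof -
    have "card (?F - T) = 1" using that F by (subst card_Diff_subset) (auto intro: finite_subset)
    then obtain e where "?F - T = {e}" by (auto simp: card_1_singleton_iff)
    then have "T = ?F - {e}" "e \<in> ?F" using that(1) by blast+
    then show ?thesis using assms(1) by (auto simp: insert_Diff_if)
  qed
  then have "{T \<in> ?C. T \<subseteq> ?F} = Set.filter (\<lambda>T. T \<in> ?C) ?T"
    by (auto simp: collinear_triples_def)
  moreover have "card {T \<in> ?C. T \<subseteq> ?F} \<in> {0, 2, 4}"
  proof -
    have "?F \<subseteq> \<Omega>" using assms by simp
    with two_graph F show ?thesis unfolding regular_two_graph_def by blast
  qed
  ultimately have card_T: "card {T \<in> ?T. T \<in> ?C} \<in> {0, 2, 4}"
    by (metis Set.filter_eq)
  have "{T \<in> ?T. T \<in> ?C} = (if col a b c then {{a, b, c}} else {}) \<union>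
      (if col a b d then {{a, b, d}} else {}) \<union> (if col a c d then {{a, c, d}} else {}) \<union>
      (if col b c d then {{b, c, d}} else {})"
    using assms(1) collinear_triples_iff_col[of a b c] collinear_triples_iff_col[of a b d]
      collinear_triples_iff_col[of a c d] collinear_triples_iff_col[of b c d] by auto
  moreover have "{a, b, c} \<noteq> {a, b, d}" "{a, b, c} \<noteq> {a, c, d}" "{a, b, c} \<noteq> {b, c, d}"
    "{a, b, d} \<noteq> {a, c, d}" "{a, b, d} \<noteq> {b, c, d}" "{a, c, d} \<noteq> {b, c, d}"
    using assms(1) by auto
  ultimately show ?thesis using card_T
    by (cases "col a b c"; cases "col a b d"; cases "col a c d"; cases "col b c d") simp_all
qed

text \<open>The \<open>lam\<close> lines through \<open>x\<close> and \<open>y\<close> contribute at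
  most two further points each, so together they cover at most 2 \<open>lam\<close> + 2 points,
  fewer than \<open>n\<close>.\<close>

lemma exists_noncollinear:
  assumes "x \<in> \<Omega>" "y \<in> \<Omega>" "x \<noteq> y"
  shows "\<exists>b\<in>\<Omega>. b \<noteq> x \<and> b \<noteq> y \<and> \<not> col x y b"
proof (rule ccontr)
  assume contra: "\<not> ?thesis"
  let ?M = "filter_mset (\<lambda>L. {x, y} \<subseteq> L) \<B>"
  have sub: "\<Omega> \<subseteq> {x, y} \<union> (\<Union>L\<in>set_mset ?M. L - {x, y})"
  proof
    fix b assume "b \<in> \<Omega>"
    show "b \<in> {x, y} \<union> (\<Union>L\<in>set_mset ?M. L - {x, y})"
    proof (cases "b = x \<or> b = y")
      case False
      then obtain d where "line x y b d" using contra \<open>b \<in> \<Omega>\<close> by (auto simp: col_def)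
      then show ?thesis using False
        by (auto simp: line_def intro!: bexI[of _ "{x, y, b, d}"])
    qed auto
  qed
  have "card (L - {x, y}) = 2" if "L \<in># ?M" for L
    using that line_block[of L] assms(3) by (subst card_Diff_subset) auto
  then have "card (\<Union>L\<in>set_mset ?M. L - {x, y}) \<le> (\<Sum>L\<in>set_mset ?M. 2)"
    by (intro order.trans[OF card_UN_le]) (auto intro!: sum_mono)
  also have "\<dots> = 2 * card (set_mset ?M)" by simp
  also have "card (set_mset ?M) \<le> size ?M"
    by (metis mset_set_set_mset_msubset size_mset_mono size_mset_set)
  also have "size ?M = lam" using design assms by (simp add: design_2_4_def)
  finally have card_U: "card (\<Union>L\<in>set_mset ?M. L - {x, y}) \<le> 2 * lam" by simp
  have "finite (\<Union>L\<in>set_mset ?M. L - {x, y})"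
    using finite_points line_block by (auto intro: finite_subset)
  then have "card \<Omega> \<le> card ({x, y} \<union> (\<Union>L\<in>set_mset ?M. L - {x, y}))"
    using sub by (intro card_mono) auto
  also have "\<dots> \<le> card {x, y} + 2 * lam"
    using card_Un_le card_U by (meson add_left_mono order.trans)
  finally have "n \<le> 2 * lam + 2" using design assms(3) by (simp add: design_2_4_def)
  then show False using many_points by simp
qed

text \<open>If {w, x, b, v} is a line, its symmetric difference with {w, x, y, z} is the line {y, z,
  b, v}.\<close>

lemma line_complement_col:
  assumes "line w x y z" "b \<noteq> y" "b \<noteq> z" "col b w x"
  shows "col b y z"
proof -
  obtain v where "line b w x v" using assms(4) by (auto simp: col_def)
  then have "line y z b v"
    using line_triangle[of w x y z b v] assms line_swap by metis
  then show ?thesis using line_imp_col line_swap by metis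
qed

text \<open>The polar-space axiom: in the local graph at \<open>a\<close>, a point is adjacent to exactly one or
  to all of the three points of a line.\<close>

lemma line_one_or_all:
  assumes L: "line a x y z" and b: "b \<in> \<Omega>" "b \<noteq> a" "b \<noteq> x" "b \<noteq> y" "b \<noteq> z"
  shows "col a b z \<longleftrightarrow> (col a b x \<longleftrightarrow> col a b y)"
proof -
  note n = line_neq[OF L]
  have 1: "col a b z \<longleftrightarrow> col b x y"
    using line_complement_col[of a z x y b] line_complement_col[of x y a z b] L b
      line_swap col_swap by metis
  have 2: "col a x y" using L line_imp_col by blast
  show ?thesis
    using col_parity[of a b x y] n b line_in_points[OF L] 1 2 by auto
qed

text \<open>Apply parity to a, b, w, x and to a, b, y, z. The remaining terms agree, since a point
  off the line is collinear with \<open>w\<close>, \<open>x\<close> iff it is collinear with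
  \<open>y\<close>, \<open>z\<close>.\<close>

lemma line_even:
  assumes L: "line w x y z" and ab: "a \<in> \<Omega>" "b \<in> \<Omega>" "a \<noteq> b"
    "a \<notin> {w, x, y, z}" "b \<notin> {w, x, y, z}"
  shows "(col a b w \<longleftrightarrow> col a b x) \<longleftrightarrow> (col a b y \<longleftrightarrow> col a b z)"
proof -
  note n = line_neq[OF L]
  have 1: "col c w x \<longleftrightarrow> col c y z" if "c \<notin> {w, x, y, z}" for c
    using line_complement_col[of w x y z c] line_complement_col[of y z w x c] L that
      line_swap(4) by blast
  have 2: "(col a b w \<longleftrightarrow> col a b x) \<longleftrightarrow> (col a w x \<longleftrightarrow> col b w x)"
    "(col a b y \<longleftrightarrow> col a b z) \<longleftrightarrow> (col a y z \<longleftrightarrow> col b y z)"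
    using col_parity[of a b w x] col_parity[of a b y z] ab n line_in_points[OF L] by simp_all
  show ?thesis using 1[OF ab(4)] 1[OF ab(5)] 2 by blast
qed

section \<open>Moves as involutions on the points\<close>

abbreviation move :: "'a \<Rightarrow> 'a \<Rightarrow> 'a \<Rightarrow> 'a" where
  "move \<equiv> mv \<B>"

lemma move_left [simp]: "move a b a = b"
  by (simp add: mv_def)

lemma move_right [simp]: "move a b b = a"
  by (simp add: mv_def)

lemma move_same [simp]: "move a a = id"
  by (simp add: mv_def fun_eq_iff)

lemma move_line:
  assumes "line a b x y"
  shows "move a b x = y"
proof -
  note n = line_neq[OF assms]
  have "(THE y. y \<notin> {a, b, x} \<and> (\<exists>L\<in>#\<B>. L = {a, b, x, y})) = y"
  proof (rule the_equality)
    show "y \<notin> {a, b, x} \<and> (\<exists>L\<in>#\<B>. L = {a, b, x, y})"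
      using n assms by (auto simp: line_def)
  next
    fix z assume "z \<notin> {a, b, x} \<and> (\<exists>L\<in>#\<B>. L = {a, b, x, z})"
    then show "z = y" using assms line_unique[of a b x z y] by (auto simp: line_def)
  qed
  moreover have "\<exists>L\<in>#\<B>. {a, b, x} \<subseteq> L"
    using assms by (auto simp: line_def intro!: bexI[of _ "{a, b, x, y}"])
  ultimately show ?thesis using n by (simp add: mv_def)
qed

lemma move_noncollinear:
  assumes "x \<noteq> a" "x \<noteq> b" "\<not> col a b x"
  shows "move a b x = x"
proof (cases "a = b")
  case False
  have "\<not> (\<exists>L\<in>#\<B>. {a, b, x} \<subseteq> L)"
    using block_superset[of a b x] assms False by (auto simp: col_def line_def)
  then show ?thesis using assms unfolding mv_def by presburger
qed simp

text \<open>The case \<open>a = b\<close> is included: then no line passes through the pair and the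
  third alternative cannot occur.\<close>

lemma move_cases:
  obtains "x = a" "move a b x = b" | "x = b" "move a b x = a"
    | y where "line a b x y" "move a b x = y"
    | "x \<noteq> a" "x \<noteq> b" "\<not> col a b x" "move a b x = x"
  using move_left move_right move_line move_noncollinear col_def by metis

lemma move_commute: "move a b = move b a"
proof
  fix x show "move a b x = move b a x"
    by (cases rule: move_cases[of x a b])
      (auto simp: move_line[OF line_swap(1)] move_noncollinear col_swap(1)[of a b])
qed

lemma move_move [simp]: "move a b (move a b x) = x"
  by (cases rule: move_cases[of x a b]) (auto simp: move_line[OF line_swap(3)])

lemma move_involution: "move a b \<circ> move a b = id"
  by (simp add: fun_eq_iff)

lemma inv_move: "inv (move a b) = move a b"
  using move_involution by (metis inv_unique_comp)

lemma move_moves_iff: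
  assumes "a \<noteq> b"
  shows "move a b x \<noteq> x \<longleftrightarrow> x = a \<or> x = b \<or> col a b x"
  using assms
  by (cases rule: move_cases[of x a b]) (auto simp: col_def dest: line_neq)

lemma move_permutes:
  assumes "a \<in> \<Omega>" "b \<in> \<Omega>"
  shows "move a b permutes \<Omega>"
proof (cases "a = b")
  case False
  have "move a b x = x" if "x \<notin> \<Omega>" for x
    using that assms move_moves_iff[OF False, of x] col_in_points by blast
  moreover have "\<exists>!y. move a b y = x" for x
    by (metis move_move)
  ultimately show ?thesis by (auto simp: permutes_def)
qed (simp add: permutes_id)

text \<open>Both moves contain the transpositions (a, b) and (c, d). By (\<triangle>), any other
  line through \<open>a\<close>, \<open>b\<close> becomes a line through \<open>c\<close>,
  \<open>d\<close> with the same remaining pair, so the other transpositions agree as well.\<close>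

lemma move_block_eq:
  assumes L: "line a b c d"
  shows "move a b = move c d"
proof
  fix x
  note n = line_neq[OF L]
  show "move a b x = move c d x"
  proof (cases rule: move_cases[of x a b])
    case 1
    then show ?thesis using move_line L line_swap by metis
  next
    case 2
    then show ?thesis using move_line L line_swap by metis
  next
    case (3 y)
    show ?thesis
    proof (cases "x = c \<or> x = d")
      case True
      then show ?thesis using move_line L line_swap by (metis move_left move_right)
    next
      case False
      then have "line c d x y" using line_triangle[OF L 3(1)] by simp
      then show ?thesis using 3 move_line by simp
    qed
  next
    case 4
    have "x \<noteq> c" "x \<noteq> d" using 4 line_imp_col[OF L] by auto
    moreover have "\<not> col c d x"
    proof
      assume "col c d x"
      then have "col x c d" using col_swap by blast
      then have "col x a b" using line_complement_col[of c d a b x] L 4 line_swap(4) by blast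
      then show False using 4 col_swap by blast
    qed
    ultimately show ?thesis using 4 move_noncollinear by simp
  qed
qed


text \<open>Each transposition in the cycle decomposition of a move can serve as its defining
  pair.\<close>

lemma move_eq_move_image:
  assumes "move a b c \<noteq> c"
  shows "move a b = move c (move a b c)"
  using assms
  by (cases rule: move_cases[of c a b]) (auto intro: move_block_eq simp: move_commute)

lemma col_line_move: "col a b x \<Longrightarrow> line a b x (move a b x)"
  by (auto simp: col_def move_line)

section \<open>Moves map lines to lines\<close>

text \<open>By \<open>line_one_or_all\<close> the move displaces either one or all of
  \<open>x\<close>, \<open>y\<close>, \<open>z\<close>. If only \<open>x\<close> moves, the image is
  the symmetric difference of the line with {a, x, b, x'}, where x' is the image of
  \<open>x\<close>.\<close>

lemma line_move_one_point:
  assumes L: "line a x y z" and b: "b \<in> \<Omega>" "b \<notin> {a, x, y, z}"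
  shows "line b (move a b x) (move a b y) (move a b z)"
proof -
  note n = line_neq[OF L]
  have one: "line b (move a b x) (move a b y) (move a b z)"
    if L: "line a x y z" and c: "col a b x" "\<not> col a b y" "\<not> col a b z" and b: "b \<notin> {a, x, y, z}"
    for x y z
  proof -
    have "move a b y = y" "move a b z = z"
      using c b line_neq[OF L] by (auto intro!: move_noncollinear)
    moreover have "line a x b (move a b x)" using col_line_move[OF c(1)] line_swap(2) by blast
    ultimately show ?thesis
      using line_triangle[of a x y z b "move a b x"] L b line_swap(4) by auto
  qed
  have "col a b z \<longleftrightarrow> (col a b x \<longleftrightarrow> col a b y)"
    using line_one_or_all[OF L] b by auto
  then consider "col a b x" "col a b y" "col a b z"
    | "col a b x" "\<not> col a b y" "\<not> col a b z"
    | "col a b y" "\<not> col a b z" "\<not> col a b x"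
    | "col a b z" "\<not> col a b x" "\<not> col a b y"
    by blast
  then show ?thesis
  proof cases
    case 1
    define x' y' z' where xyz': "x' = move a b x" "y' = move a b y" "z' = move a b z"
    have l: "line a b x x'" "line a b y y'" "line a b z z'"
      using 1 col_line_move by (auto simp: xyz')
    note n' = line_neq[OF l(1)] line_neq[OF l(2)] line_neq[OF l(3)]
    have notin: "x' \<noteq> y" "x' \<noteq> z" "y' \<noteq> x" "y' \<noteq> z" "z' \<noteq> x" "z' \<noteq> y"
      using line_unique[of a x y b z] line_unique[of a x z b y] line_unique[of a y z b x] l L b
        line_swap by (metis insertCI)+
    have neq: "x' \<noteq> y'" "x' \<noteq> z'" "y' \<noteq> z'" using n xyz' by (metis move_move)+
    \<comment> \<open>Three symmetric differences in succession: the given line with {a, x, b, x'},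
      the result with {a, b, y, y'}, and that result with {a, b, z, z'}.\<close>
    have "line y z b x'"
      using line_triangle[of a x y z b x'] L l(1) b line_swap(2) by auto
    then have "line b y z x'" by (rule line_perms) auto
    moreover have "line b y a y'" using l(2) by (rule line_perms) auto
    ultimately have "line z x' a y'" using line_triangle n n' by metis
    then have "line a z x' y'" by (rule line_perms) auto
    moreover have "line a z b z'" using l(3) by (rule line_perms) auto
    ultimately have "line x' y' b z'" using line_triangle n' by metis
    then show ?thesis unfolding xyz' by (rule line_perms) auto
  next
    case 2
    then show ?thesis using one L b by blast
  next
    case 3
    have "line a y z x" using L by (rule line_perms) auto
    from one[OF this] 3 b have "line b (move a b y) (move a b z) (move a b x)" by auto
    then show ?thesis by (rule line_perms) auto
  next
    case 4
    have "line a z x y" using L by (rule line_perms) auto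
    from one[OF this] 4 b have "line b (move a b z) (move a b x) (move a b y)" by auto
    then show ?thesis by (rule line_perms) auto
  qed
qed

text \<open>Unless \<open>w\<close> and \<open>x\<close> are swapped, the two lines through
  \<open>a\<close>, \<open>b\<close> containing them yield {w, x, w', x'}, and its symmetric
  difference with the given line is {y, z, w', x'}.\<close>

lemma line_move_two_moved:
  assumes L: "line w x y z" and ab: "a \<notin> {w, x, y, z}" "b \<notin> {w, x, y, z}"
    and c: "col a b w" "col a b x" "\<not> col a b y" "\<not> col a b z"
  shows "line (move a b w) (move a b x) (move a b y) (move a b z)"
proof -
  note n = line_neq[OF L]
  define w' x' where wx': "w' = move a b w" "x' = move a b x"
  have l: "line a b w w'" "line a b x x'"
    using c col_line_move by (auto simp: wx')
  have yz: "move a b y = y" "move a b z = z"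
    using c ab by (auto intro!: move_noncollinear)
  have ny: "w' \<noteq> y" "w' \<noteq> z" using l c line_imp_col by blast+
  show ?thesis
  proof (cases "w' = x")
    case True
    then have "x' = w" using wx' by (metis move_move)
    have "line x w y z" using L by (rule line_perms) auto
    then show ?thesis using True \<open>x' = w\<close> yz wx' by simp
  next
    case False
    then have "line w w' x x'" using line_triangle[OF l] n by auto
    then have "line w x w' x'" by (rule line_swap)
    then have "line y z w' x'" using line_triangle[OF L] ny by auto
    then have "line w' x' y z" by (rule line_swap)
    then show ?thesis using yz wx' by simp
  qed
qed

text \<open>The line is mapped to itself: {w, x, y, y'} is a line by (\<triangle>), with y' the
  image of \<open>y\<close>, and it shares three points with {w, x, y, z}, so y' is
  \<open>z\<close>.\<close>

lemma line_move_swapped_pair: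
  assumes "line w x y z" "line a b w x" "col a b y"
  shows "line (move a b w) (move a b x) (move a b y) (move a b z)"
proof -
  have l: "line a b y (move a b y)" using assms(3) col_line_move by blast
  have "line w x y (move a b y)"
    using line_triangle[OF assms(2) l] line_neq[OF assms(1)] by auto
  then have y: "move a b y = z" using line_unique assms(1) by blast
  then have z: "move a b z = y" by (metis move_move)
  have "move a b w = x" "move a b x = w" using assms(2) move_line line_swap by metis+
  moreover have "line x w z y" using assms(1) by (rule line_perms) auto
  ultimately show ?thesis using y z by simp
qed

lemma line_move_all_moved:
  assumes L: "line w x y z"
    and c: "col a b w" "col a b x" "col a b y" "col a b z"
  shows "line (move a b w) (move a b x) (move a b y) (move a b z)"
proof -
  note n = line_neq[OF L]
  define w' x' y' z' where def': "w' = move a b w" "x' = move a b x" "y' = move a b y" "z' = move a b z"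
  have l: "line a b w w'" "line a b x x'" "line a b y y'" "line a b z z'"
    using c col_line_move by (auto simp: def')
  have neq: "w' \<noteq> x'" "w' \<noteq> y'" "x' \<noteq> y'"
    using n unfolding def' by (metis move_move)+
  \<comment> \<open>The first four cases contain a swapped pair. The last excludes exactly the
    coincidences that would block the symmetric differences formed there.\<close>
  consider "w' = x" | "w' = y" | "w' = z" | "y' = z"
    | "w' \<noteq> x" "w' \<noteq> y" "w' \<noteq> z" "y' \<noteq> z" by blast
  then show ?thesis
  proof cases
    case 1
    then show ?thesis using line_move_swapped_pair L l c by metis
  next
    case 2
    have "line w y x z" using L by (rule line_perms) auto
    then have "line (move a b w) (move a b y) (move a b x) (move a b z)"
      using line_move_swapped_pair 2 l c by metis
    then show ?thesis by (rule line_perms) auto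
  next
    case 3
    have "line w z x y" using L by (rule line_perms) auto
    then have "line (move a b w) (move a b z) (move a b x) (move a b y)"
      using line_move_swapped_pair 3 l c by metis
    then show ?thesis by (rule line_perms) auto
  next
    case 4
    have "line y z w x" using L by (rule line_perms) auto
    then have "line (move a b y) (move a b z) (move a b w) (move a b x)"
      using line_move_swapped_pair 4 l c by metis
    then show ?thesis by (rule line_perms) auto
  next
    case 5
    have "line w w' x x'" using line_triangle[OF l(1,2)] n 5 by auto
    then have "line w x w' x'" by (rule line_swap)
    then have "line y z w' x'" using line_triangle[OF L] 5 by auto
    moreover have "line y y' z z'" using line_triangle[OF l(3,4)] n 5 by auto
    then have "line y z y' z'" by (rule line_swap)
    ultimately have "line w' x' y' z'" using line_triangle neq by metis
    then show ?thesis by (simp add: def')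
  qed
qed

text \<open>By \<open>line_even\<close> the number of displaced points on the line is even, which
  leaves four, none, or one of six pairs.\<close>

lemma line_move_no_point:
  assumes L: "line w x y z" and ab: "a \<in> \<Omega>" "b \<in> \<Omega>" "a \<noteq> b"
    "a \<notin> {w, x, y, z}" "b \<notin> {w, x, y, z}"
  shows "line (move a b w) (move a b x) (move a b y) (move a b z)"
proof -
  have *: "line (move a b w) (move a b x) (move a b y) (move a b z)"
    if "{w', x', y', z'} = {w, x, y, z}"
      "col a b w'" "col a b x'" "\<not> col a b y'" "\<not> col a b z'" for w' x' y' z'
  proof -
    have "line (move a b w') (move a b x') (move a b y') (move a b z')"
    proof (rule line_move_two_moved)
      show "line w' x' y' z'" using line_perms[OF L that(1)] .
      show "a \<notin> {w', x', y', z'}" "b \<notin> {w', x', y', z'}" using ab that(1) by auto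
    qed (fact that)+
    moreover have "{move a b w, move a b x, move a b y, move a b z} =
        {move a b w', move a b x', move a b y', move a b z'}"
      using arg_cong[OF that(1), of "image (move a b)"] by simp
    ultimately show ?thesis by (rule line_perms)
  qed
  have "(col a b w \<longleftrightarrow> col a b x) \<longleftrightarrow> (col a b y \<longleftrightarrow> col a b z)"
    using line_even[OF assms] .
  then consider "col a b w" "col a b x" "col a b y" "col a b z"
    | "\<not> col a b w" "\<not> col a b x" "\<not> col a b y" "\<not> col a b z"
    | "col a b w" "col a b x" "\<not> col a b y" "\<not> col a b z"
    | "col a b w" "col a b y" "\<not> col a b x" "\<not> col a b z"
    | "col a b w" "col a b z" "\<not> col a b x" "\<not> col a b y"
    | "col a b x" "col a b y" "\<not> col a b w" "\<not> col a b z"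
    | "col a b x" "col a b z" "\<not> col a b w" "\<not> col a b y"
    | "col a b y" "col a b z" "\<not> col a b w" "\<not> col a b x"
    by blast
  then show ?thesis
  proof cases
    case 1
    then show ?thesis using line_move_all_moved[OF L] by blast
  next
    case 2
    then have "move a b w = w" "move a b x = x" "move a b y = y" "move a b z = z"
      using ab by (auto intro!: move_noncollinear)
    then show ?thesis using L by simp
  next
    case 3 then show ?thesis by (intro *[of w x y z]) auto
  next
    case 4 then show ?thesis by (intro *[of w y x z]) auto
  next
    case 5 then show ?thesis by (intro *[of w z x y]) auto
  next
    case 6 then show ?thesis by (intro *[of x y w z]) auto
  next
    case 7 then show ?thesis by (intro *[of x z w y]) auto
  next
    case 8 then show ?thesis by (intro *[of y z w x]) auto
  qed
qed

lemma block_eq_line: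
  assumes "L \<in># \<B>" "a \<in> L"
  obtains x y z where "L = {a, x, y, z}"
proof -
  have "card (L - {a}) = 3"
    using line_block[OF assms(1)] assms(2) by simp
  then obtain x y z where "L - {a} = {x, y, z}" unfolding card_3_iff by blast
  then have "L = {a, x, y, z}" using assms(2) insert_Diff by metis
  then show ?thesis by (rule that)
qed

text \<open>The cases are the possible intersections of {a, b} with the block. A block containing
  both points is mapped to itself.\<close>

lemma move_image_block:
  assumes L: "L \<in># \<B>" and ab: "a \<in> \<Omega>" "b \<in> \<Omega>"
  shows "move a b ` L \<in># \<B>"
proof -
  have one: "move a b ` L \<in># \<B>" if "a \<in> L" "b \<notin> L" "b \<in> \<Omega>" for a b
  proof -
    obtain x y z where xyz: "L = {a, x, y, z}" using block_eq_line[OF L \<open>a \<in> L\<close>] .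
    then have "line a x y z" using L by (simp add: line_def)
    then have "line b (move a b x) (move a b y) (move a b z)"
      using that(2,3) unfolding xyz by (intro line_move_one_point)
    then show ?thesis by (simp add: line_def xyz)
  qed
  consider "a = b" | "a \<noteq> b" "a \<in> L" "b \<in> L" | "a \<in> L" "b \<notin> L" | "b \<in> L" "a \<notin> L"
    | "a \<noteq> b" "a \<notin> L" "b \<notin> L" by blast
  then show ?thesis
  proof cases
    case 1
    then show ?thesis using L by simp
  next
    case 2
    obtain x y z where xyz: "L = {a, x, y, z}" using block_eq_line[OF L \<open>a \<in> L\<close>] .
    from 2 xyz have "b = x \<or> b = y \<or> b = z" by blast
    then have "L = {a, b, y, z} \<or> L = {a, b, x, z} \<or> L = {a, b, x, y}"
      using xyz by (elim disjE) (simp_all add: insert_commute)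
    then obtain u v where uv: "L = {a, b, u, v}" by blast
    then have "line a b u v" using L by (simp add: line_def)
    then have "move a b u = v" "move a b v = u" using move_line line_swap by blast+
    then have "move a b ` L = L" unfolding uv by (simp add: insert_commute)
    then show ?thesis using L by simp
  next
    case 3
    then show ?thesis using one ab by blast
  next
    case 4
    then show ?thesis using one[of b a] ab unfolding move_commute[of a b] by blast
  next
    case 5
    have "L \<noteq> {}" using line_block[OF L] by auto
    then obtain w where "w \<in> L" by blast
    then obtain x y z where wxyz: "L = {w, x, y, z}" by (rule block_eq_line[OF L])
    then have "line w x y z" using L by (simp add: line_def)
    then have "line (move a b w) (move a b x) (move a b y) (move a b z)"
      using 5 ab unfolding wxyz by (intro line_move_no_point)
    then show ?thesis by (simp add: line_def wxyz)
  qed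
qed

section \<open>Automorphisms and the group generated by the moves\<close>

text \<open>Multiplicities can be ignored because supersimplicity excludes repeated blocks. The
  equivalence, rather than an implication, makes closure under inverses immediate.\<close>

definition automorphism :: "('a \<Rightarrow> 'a) \<Rightarrow> bool" where
  "automorphism g \<longleftrightarrow> g permutes \<Omega> \<and> (\<forall>a b c d. line (g a) (g b) (g c) (g d) \<longleftrightarrow> line a b c d)"

lemma automorphism_move:
  assumes "a \<in> \<Omega>" "b \<in> \<Omega>"
  shows "automorphism (move a b)"
proof -
  have "line (move a b w) (move a b x) (move a b y) (move a b z)" if "line w x y z" for w x y z
    using move_image_block[of "{w, x, y, z}" a b] that assms by (simp add: line_def)
  then show ?thesis
    using move_permutes[OF assms] unfolding automorphism_def by (metis move_move)
qed

lemma automorphism_id: "automorphism id"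
  by (simp add: automorphism_def permutes_id)

lemma automorphism_comp: "automorphism g \<Longrightarrow> automorphism h \<Longrightarrow> automorphism (g \<circ> h)"
  by (auto simp: automorphism_def intro: permutes_compose)

lemma automorphism_inv:
  assumes "automorphism g"
  shows "automorphism (inv g)"
proof -
  have g: "g permutes \<Omega>" using assms by (simp add: automorphism_def)
  then have "g (inv g x) = x" for x using permutes_inverses(1) by metis
  then show ?thesis
    using assms permutes_inv[OF g] unfolding automorphism_def by metis
qed

text \<open>A move is determined by its two points and the lines, and \<open>g\<close> preserves the
  lines.\<close>

lemma automorphism_conj:
  assumes "automorphism g"
  shows "g \<circ> move a b \<circ> inv g = move (g a) (g b)"
proof -
  have g: "g permutes \<Omega>" and l: "\<And>a b c d. line (g a) (g b) (g c) (g d) \<longleftrightarrow> line a b c d"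
    using assms by (auto simp: automorphism_def)
  have gi: "g (inv g x) = x" for x using permutes_inverses(1)[OF g] .
  have "g (move a b x) = move (g a) (g b) (g x)" for x
  proof (cases rule: move_cases[of x a b])
    case (3 y)
    then show ?thesis using move_line l by metis
  next
    case 4
    have "\<not> col (g a) (g b) (g x)" using 4(3) l gi unfolding col_def by metis
    moreover have "g x \<noteq> g a" "g x \<noteq> g b" using 4 permutes_inj[OF g] by (auto dest: injD)
    ultimately show ?thesis using 4 move_noncollinear by simp
  qed auto
  then show ?thesis using gi by (auto simp: fun_eq_iff)
qed

text \<open>Pairs with \<open>a = b\<close> are left out because [a, a] is the identity and hence
  not an involution.\<close>

definition moves :: "('a \<Rightarrow> 'a) set" where
  "moves = {move a b | a b. a \<in> \<Omega> \<and> b \<in> \<Omega> \<and> a \<noteq> b}"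

definition move_group :: "('a \<Rightarrow> 'a) set" where
  "move_group = generated moves"

lemma moves_cases:
  assumes "e \<in> moves"
  obtains a b where "e = move a b" "a \<in> \<Omega>" "b \<in> \<Omega>" "a \<noteq> b"
  using assms unfolding moves_def by blast

lemma move_in_moves: "a \<in> \<Omega> \<Longrightarrow> b \<in> \<Omega> \<Longrightarrow> a \<noteq> b \<Longrightarrow> move a b \<in> moves"
  unfolding moves_def by blast

lemma move_group_id: "id \<in> move_group"
  unfolding move_group_def by (rule generated.gen_id)

lemma move_group_comp: "g \<in> move_group \<Longrightarrow> h \<in> move_group \<Longrightarrow> g \<circ> h \<in> move_group"
  unfolding move_group_def by (rule generated.gen_comp)

lemma move_group_inv: "g \<in> move_group \<Longrightarrow> inv g \<in> move_group"
  unfolding move_group_def by (rule generated.gen_inv)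

lemma automorphism_move_group: "g \<in> move_group \<Longrightarrow> automorphism g"
  unfolding move_group_def
  by (induction rule: generated.induct)
    (blast intro: automorphism_id automorphism_move automorphism_comp automorphism_inv elim: moves_cases)+

lemma move_group_permutes: "g \<in> move_group \<Longrightarrow> g permutes \<Omega>"
  using automorphism_move_group automorphism_def by blast

lemma move_in_move_group:
  assumes "a \<in> \<Omega>" "b \<in> \<Omega>"
  shows "move a b \<in> move_group"
proof (cases "a = b")
  case True
  then show ?thesis by (simp add: move_group_id)
next
  case False
  then show ?thesis
    using assms unfolding move_group_def by (intro generated.gen_elem move_in_moves)
qed

lemma move_conj:
  assumes "a \<in> \<Omega>" "b \<in> \<Omega>"
  shows "move a b \<circ> move c d \<circ> move a b = move (move a b c) (move a b d)"
  using automorphism_conj[OF automorphism_move[OF assms], of c d] by (simp add: inv_move)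

section \<open>Move sequences from a base point\<close>

text \<open>The recursion of \<open>mv_seq\<close> works at the front of the list; extending a
  sequence at its end is what multiplies its permutation on the left by a move.\<close>

lemma mv_seq_snoc:
  "as \<noteq> [] \<Longrightarrow> mv_seq \<B> (as @ [c]) = move (last as) c \<circ> mv_seq \<B> as"
proof (induction as rule: induct_list012)
  case (3 x y zs)
  then show ?case by (simp add: comp_assoc)
qed auto

lemma mv_seq_in_move_group:
  "set as \<subseteq> \<Omega> \<Longrightarrow> mv_seq \<B> as \<in> move_group"
  by (induction as rule: induct_list012)
    (auto intro: move_group_id move_group_comp move_in_move_group)

text \<open>A move \<open>[x, y]\<close> can be written as a move sequence starting at any given point \<open>a\<close>: if
  \<open>a, x, y, b\<close> form a line it equals \<open>[a, b]\<close>, and if \<open>a\<close> is not collinear with \<open>x, y\<close>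
  it equals \<open>[a, x, y, a]\<close>.\<close>

lemma move_comp_L_infty:
  assumes g: "g \<in> L_infty \<Omega> \<B> pinf" and pinf: "pinf \<in> \<Omega>"
    and xy: "x \<in> \<Omega>" "y \<in> \<Omega>" "x \<noteq> y"
  shows "move x y \<circ> g \<in> L_infty \<Omega> \<B> pinf"
proof -
  obtain as where as: "set as \<subseteq> \<Omega>" "g = mv_seq \<B> (pinf # as)"
    using g by (auto simp: L_infty_def)
  define a where "a = last (pinf # as)"
  have "a \<in> \<Omega>" using as(1) pinf by (auto simp: a_def)
  have append1: "move a c \<circ> g = mv_seq \<B> (pinf # as @ [c])" for c
    using mv_seq_snoc[of "pinf # as" c] by (simp add: as(2) a_def)
  have append: "move a c \<circ> g \<in> L_infty \<Omega> \<B> pinf" if "c \<in> \<Omega>" for c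
    unfolding append1 L_infty_def using that as(1)
    by (intro CollectI exI[of _ "as @ [c]"]) auto
  consider "a = x" | "a = y" | b where "line a x y b" | "a \<noteq> x" "a \<noteq> y" "\<not> col a x y"
    by (auto simp: col_def)
  then show ?thesis
  proof cases
    case 1
    then show ?thesis using append xy by simp
  next
    case 2
    then show ?thesis using append[of x] xy move_commute by metis
  next
    case 3
    then have "line a b x y" by (rule line_perms) auto
    then show ?thesis using append[of b] move_block_eq line_in_points(2) by metis
  next
    case 4
    have fix_a: "move x y a = a" using 4 col_swap by (intro move_noncollinear) blast+
    have "move x y \<circ> move a x \<circ> move x y = move a y"
      using move_conj[OF xy(1,2), of a x] fix_a by simp
    then have "move y a \<circ> move x y \<circ> move a x = move x y"
      by (metis move_commute move_involution comp_assoc comp_id id_comp)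
    then have "move x y \<circ> g = move y a \<circ> (move x y \<circ> (move a x \<circ> g))"
      by (metis comp_assoc)
    also have "\<dots> = mv_seq \<B> (pinf # as @ [x, y, a])"
      using append1[of x] mv_seq_snoc[of "pinf # as @ [x]" y]
        mv_seq_snoc[of "pinf # as @ [x, y]" a] by simp
    also have "\<dots> \<in> L_infty \<Omega> \<B> pinf"
      unfolding L_infty_def using as(1) xy \<open>a \<in> \<Omega>\<close>
      by (intro CollectI exI[of _ "as @ [x, y, a]"]) auto
    finally show ?thesis .
  qed
qed

lemma L_infty_eq_move_group:
  assumes pinf: "pinf \<in> \<Omega>"
  shows "L_infty \<Omega> \<B> pinf = move_group"
proof
  show "L_infty \<Omega> \<B> pinf \<subseteq> move_group"
    using mv_seq_in_move_group pinf by (auto simp: L_infty_def)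
next
  \<comment> \<open>The claim for \<open>inv g\<close> is carried along because
    \<open>generated\<close> has a rule for inverses, where the claim for \<open>g\<close> alone
    would not support the induction.\<close>
  have comp: "(\<forall>h\<in>L_infty \<Omega> \<B> pinf. g \<circ> h \<in> L_infty \<Omega> \<B> pinf \<and> inv g \<circ> h \<in> L_infty \<Omega> \<B> pinf)"
    if "g \<in> move_group" for g
    using that unfolding move_group_def
  proof (induction rule: generated.induct)
    case gen_id
    then show ?case by simp
  next
    case (gen_elem e)
    then obtain a b where "e = move a b" "a \<in> \<Omega>" "b \<in> \<Omega>" "a \<noteq> b" by (rule moves_cases)
    then show ?case using move_comp_L_infty pinf by (metis inv_move)
  next
    case (gen_comp g h)
    have "inv (g \<circ> h) = inv h \<circ> inv g"
      using gen_comp.hyps move_group_permutes permutes_bij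
      unfolding move_group_def by (intro o_inv_distrib) blast+
    then show ?case using gen_comp.IH by (metis comp_assoc)
  next
    case (gen_inv g)
    have "inv (inv g) = g"
      using gen_inv.hyps move_group_permutes permutes_inv_inv unfolding move_group_def by blast
    then show ?case using gen_inv.IH by simp
  qed
  have "id \<in> L_infty \<Omega> \<B> pinf"
    unfolding L_infty_def by (intro CollectI exI[of _ "[]"]) auto
  then show "move_group \<subseteq> L_infty \<Omega> \<B> pinf" using comp by (metis comp_id subsetI)
qed

lemma move_group_subgroup: "is_subgroup_Sym \<Omega> move_group"
  unfolding is_subgroup_Sym_def Sym_def
  using move_group_permutes move_group_id move_group_comp move_group_inv by blast

section \<open>Products of two moves and the 3-transposition property\<close>

lemma perm_order_le_3:
  assumes "p ^^ 2 = id \<or> p ^^ 3 = id"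
  shows "perm_order p \<in> {1, 2, 3}"
proof -
  obtain k where k: "0 < k" "k \<le> 3" "p ^^ k = id"
    using assms by (metis zero_less_numeral order_refl numeral_le_iff semiring_norm(69,72))
  then have "0 < perm_order p" "perm_order p \<le> k"
    unfolding perm_order_def
    using LeastI[of "\<lambda>k. 0 < k \<and> p ^^ k = id" k] Least_le[of "\<lambda>k. 0 < k \<and> p ^^ k = id" k] by auto
  then show ?thesis using k(2) by auto
qed

lemma funpow_2_comp: "g \<circ> h \<circ> g = h \<Longrightarrow> h \<circ> h = id \<Longrightarrow> (g \<circ> h) ^^ 2 = id"
  by (simp add: numeral_2_eq_2 fun_eq_iff)

text \<open>The cube is (ghg)(hgh), which equals (hgh)(hgh) and cancels.\<close>

lemma funpow_3_comp:
  "g \<circ> h \<circ> g = h \<circ> g \<circ> h \<Longrightarrow> g \<circ> g = id \<Longrightarrow> h \<circ> h = id \<Longrightarrow> (g \<circ> h) ^^ 3 = id"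
  by (simp add: numeral_3_eq_3 fun_eq_iff)

text \<open>Write [a, b] as [c, c'] with c' the image of \<open>c\<close>. As \<open>d\<close> is
  fixed, \<open>c\<close>, \<open>d\<close>, c' are not collinear, so [c, d] fixes c'. Both sides
  then equal [c', d], just as for the transpositions (c, c') and (c, d).\<close>

lemma move_braid:
  assumes ab: "a \<in> \<Omega>" "b \<in> \<Omega>" and cd: "c \<in> \<Omega>" "d \<in> \<Omega>" "c \<noteq> d"
    and c: "move a b c \<noteq> c" and d: "move a b d = d"
  shows "move a b \<circ> move c d \<circ> move a b = move c d \<circ> move a b \<circ> move c d"
proof -
  define c' where "c' = move a b c"
  have g: "move a b = move c c'" using move_eq_move_image[OF c] by (simp add: c'_def)
  have "c' \<noteq> c" "c' \<noteq> d" using c d cd(3) unfolding c'_def by (metis move_move)+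
  moreover have "\<not> col c d c'"
    using d \<open>c' \<noteq> c\<close> move_moves_iff[of c c' d] col_swap(2) unfolding g by metis
  ultimately have "move c d c' = c'" by (intro move_noncollinear) auto
  then have "move c d \<circ> move c c' \<circ> move c d = move d c'"
    using move_conj[OF cd(1,2), of c c'] by simp
  moreover have "move a b \<circ> move c d \<circ> move a b = move c' d"
    using move_conj[OF ab, of c d] d by (simp add: c'_def)
  ultimately show ?thesis using g move_commute by metis
qed

text \<open>If [a, b] displaces none or both of \<open>c\<close>, \<open>d\<close>, the moves
  commute; if it displaces exactly one, they braid.\<close>

lemma move_comp_order:
  assumes ab: "a \<in> \<Omega>" "b \<in> \<Omega>" and cd: "c \<in> \<Omega>" "d \<in> \<Omega>" "c \<noteq> d"
  shows "perm_order (move a b \<circ> move c d) \<in> {1, 2, 3}"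
proof (rule perm_order_le_3)
  let ?g = "move a b" and ?h = "move c d"
  consider "?g c = c" "?g d = d" | "?g c \<noteq> c" "?g d = d" | "?g c = c" "?g d \<noteq> d"
    | "?g c \<noteq> c" "?g d \<noteq> d" by blast
  then show "(?g \<circ> ?h) ^^ 2 = id \<or> (?g \<circ> ?h) ^^ 3 = id"
  proof cases
    case 1
    then have "?g \<circ> ?h \<circ> ?g = ?h" using move_conj[OF ab, of c d] by simp
    then show ?thesis using funpow_2_comp move_involution by blast
  next
    case 2
    then show ?thesis using move_braid[OF ab cd] funpow_3_comp move_involution by blast
  next
    case 3
    then have "?g \<circ> ?h \<circ> ?g = ?h \<circ> ?g \<circ> ?h"
      using move_braid[OF ab cd(2,1)] cd(3) by (simp add: move_commute[of d c])
    then show ?thesis using funpow_3_comp move_involution by blast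
  next
    case 4
    define c' d' where cd': "c' = ?g c" "d' = ?g d"
    have g: "?g = move c c'" using move_eq_move_image[of a b c] 4 by (simp add: cd')
    \<comment> \<open>Either [a, b] swaps \<open>c\<close> and \<open>d\<close>, or {c, d, c', d'}
      is a line and its complementary pairs define the same move.\<close>
    have "move c' d' = ?h"
    proof (cases "d = c'")
      case True
      then have "d' = c" using cd' by (metis move_move)
      then show ?thesis using True by (simp add: move_commute)
    next
      case False
      have "col c c' d"
        using 4 g False cd move_moves_iff[of c c' d] cd' by metis
      then have "line c c' d d'" using col_line_move cd' g by metis
      then have "line c d c' d'" by (rule line_swap)
      then show ?thesis using move_block_eq by metis
    qed
    then have "?g \<circ> ?h \<circ> ?g = ?h" using move_conj[OF ab, of c d] by (simp add: cd')
    then show ?thesis using funpow_2_comp move_involution by blast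
  qed
qed

lemma move_group_three_transposition: "three_transposition_group move_group moves"
  unfolding three_transposition_group_def
proof (intro conjI ballI)
  fix e assume "e \<in> moves"
  then obtain a b where e: "e = move a b" "a \<noteq> b" by (rule moves_cases)
  then show "e \<noteq> id" using move_left[of a b] by (metis id_apply)
  show "e \<circ> e = id" using e move_involution by simp
next
  fix g e assume g: "g \<in> move_group" and "e \<in> moves"
  from this(2) obtain a b where e: "e = move a b" "a \<in> \<Omega>" "b \<in> \<Omega>" "a \<noteq> b"
    by (rule moves_cases)
  have gp: "g permutes \<Omega>" using g move_group_permutes by blast
  have "g a \<noteq> g b" using permutes_inj[OF gp] e(4) by (auto dest: injD)
  moreover have "g a \<in> \<Omega>" "g b \<in> \<Omega>" using permutes_in_image[OF gp] e by auto
  moreover have "g \<circ> e \<circ> inv g = move (g a) (g b)"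
    using automorphism_conj[OF automorphism_move_group[OF g]] e(1) by simp
  ultimately show "g \<circ> e \<circ> inv g \<in> moves" using move_in_moves by metis
next
  fix g h assume "g \<in> moves" "h \<in> moves"
  then show "perm_order (g \<circ> h) \<in> {1, 2, 3}" using move_comp_order by (metis moves_cases)
qed (rule move_group_def)

section \<open>Orbits and elements of point stabilisers\<close>

text \<open>\<open>N\<close> is a union of components of the non-adjacency graph at
  \<open>x\<close>, so a point outside \<open>N\<close> is adjacent to every point of
  \<open>N\<close>. For \<open>y\<close> in \<open>N\<close> and \<open>z\<close> outside, this is
  played off against the line {x, y, z, w}.\<close>

lemma noncollinear_connected:
  assumes x: "x \<in> \<Omega>" and N: "N \<subseteq> \<Omega> - {x}" "N \<noteq> {}"
    and closed: "\<And>u v. u \<in> N \<Longrightarrow> v \<in> \<Omega> \<Longrightarrow> v \<noteq> x \<Longrightarrow> v \<noteq> u \<Longrightarrow> \<not> col x u v \<Longrightarrow> v \<in> N"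
  shows "N = \<Omega> - {x}"
proof -
  obtain y where y: "y \<in> N" "y \<in> \<Omega>" "y \<noteq> x" using N by blast
  have "z \<in> N" if z: "z \<in> \<Omega>" "z \<noteq> x" for z
  proof (rule ccontr)
    assume contra: "z \<notin> N"
    then have "col x y z" using closed y z by blast
    then obtain w where L: "line x y z w" by (auto simp: col_def)
    note n = line_neq[OF L] and pts = line_in_points[OF L]
    \<comment> \<open>A non-neighbour \<open>b\<close> of \<open>y\<close> lies in \<open>N\<close>,
      hence is adjacent to \<open>z\<close>; being adjacent to just one point of the line, it misses
      \<open>w\<close> and so pulls \<open>w\<close> into \<open>N\<close>.\<close>
    obtain b where b: "b \<in> \<Omega>" "b \<noteq> x" "b \<noteq> y" "\<not> col x y b"
      using exists_noncollinear[OF x \<open>y \<in> \<Omega>\<close>] y by metis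
    then have "b \<in> N" using closed y by blast
    have b_off: "b \<noteq> z" "b \<noteq> w" using b L line_imp_col by blast+
    have "col x b z" using closed[OF \<open>b \<in> N\<close>] z b_off contra by blast
    moreover have "\<not> col x b y" using b col_swap(2) by blast
    ultimately have "\<not> col x b w" using line_one_or_all[OF L b(1)] b b_off by blast
    then have "w \<in> N" using closed[OF \<open>b \<in> N\<close>, of w] b_off n pts by blast
    \<comment> \<open>A non-neighbour b' of \<open>z\<close> lies outside \<open>N\<close>, hence is
      adjacent to both \<open>y\<close> and \<open>w\<close>, and the one-or-all rule would make it
      adjacent to \<open>z\<close>.\<close>
    obtain b' where b': "b' \<in> \<Omega>" "b' \<noteq> x" "b' \<noteq> z" "\<not> col x z b'"
      using exists_noncollinear[OF x \<open>z \<in> \<Omega>\<close>] z by metis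
    have zb': "\<not> col x b' z" using b' col_swap(2) by blast
    have b'_off: "b' \<noteq> y" "b' \<noteq> w" using b' L line_imp_col col_swap by metis+
    have "b' \<notin> N" using closed[of b' z] zb' z b' contra by blast
    then have "col x y b'" "col x w b'" using closed y \<open>w \<in> N\<close> b' b'_off by blast+
    then have "col x b' y" "col x b' w" using col_swap(2) by blast+
    then show False using line_one_or_all[OF L b'(1)] b' b'_off zb' by blast
  qed
  then show ?thesis using N by blast
qed

lemma move_in_stabiliser:
  assumes "a \<in> \<Omega>" "b \<in> \<Omega>" "x \<noteq> a" "x \<noteq> b" "\<not> col x a b"
  shows "move a b \<in> stabiliser move_group x"
proof -
  have "\<not> col a b x" using assms(5) col_swap(1)[of x a b] col_swap(2)[of a x b] by simp
  then have "move a b x = x" using assms(3,4) move_noncollinear by blast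
  then show ?thesis using move_in_move_group[OF assms(1,2)] unfolding stabiliser_def by blast
qed

lemma stabiliser_comp:
  "g \<in> stabiliser move_group x \<Longrightarrow> h \<in> stabiliser move_group x \<Longrightarrow> g \<circ> h \<in> stabiliser move_group x"
  by (simp add: stabiliser_def move_group_comp)

text \<open>The orbit of \<open>y\<close> is closed under non-adjacency, since [u, v] fixes
  \<open>x\<close> and sends \<open>u\<close> to \<open>v\<close> when \<open>x\<close>,
  \<open>u\<close>, \<open>v\<close> are not collinear.\<close>

lemma stabiliser_orbit:
  assumes x: "x \<in> \<Omega>" and y: "y \<in> \<Omega>" "y \<noteq> x" and z: "z \<in> \<Omega>" "z \<noteq> x"
  shows "\<exists>h\<in>stabiliser move_group x. h y = z"
proof -
  let ?N = "{v \<in> \<Omega> - {x}. \<exists>h\<in>stabiliser move_group x. h y = v}"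
  have "id \<in> stabiliser move_group x" by (simp add: stabiliser_def move_group_id)
  then have "\<exists>h\<in>stabiliser move_group x. h y = y" by (rule bexI[rotated]) simp
  then have "y \<in> ?N" using y by blast
  have "?N = \<Omega> - {x}"
  proof (rule noncollinear_connected[OF x])
    show "?N \<subseteq> \<Omega> - {x}" by blast
    show "?N \<noteq> {}" using \<open>y \<in> ?N\<close> by blast
    fix u v assume "u \<in> ?N" and v: "v \<in> \<Omega>" "v \<noteq> x" "v \<noteq> u" "\<not> col x u v"
    then obtain h where h: "h \<in> stabiliser move_group x" "h y = u" "u \<in> \<Omega>" "u \<noteq> x" by blast
    then have "move u v \<in> stabiliser move_group x" using v move_in_stabiliser by metis
    then have "move u v \<circ> h \<in> stabiliser move_group x" using h stabiliser_comp by blast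
    moreover have "(move u v \<circ> h) y = v" using h by simp
    ultimately show "v \<in> ?N" using v(1,2) by blast
  qed
  then show ?thesis using z by blast
qed

lemma three_points:
  assumes "x \<in> \<Omega>"
  obtains y z where "y \<in> \<Omega>" "z \<in> \<Omega>" "y \<noteq> x" "z \<noteq> x" "y \<noteq> z"
proof -
  have "card \<Omega> = n" using design by (simp add: design_2_4_def)
  then have "card \<Omega> > 1" using many_points by simp
  then obtain y where y: "y \<in> \<Omega>" "y \<noteq> x"
    using assms by (metis card_1_singleton_iff is_singletonI' less_irrefl is_singleton_altdef empty_iff)
  then obtain z where "z \<in> \<Omega>" "z \<noteq> x" "z \<noteq> y" using exists_noncollinear[OF assms y(1)] by metis
  then show ?thesis using y that by metis
qed

text \<open>The moves inside the stabiliser of \<open>x\<close> need not generate a primitive group: for \<open>n = 10\<close>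
  they preserve a partition of the remaining nine points, forming a \<open>3 \<times> 3\<close> grid, into
  transversals. The products below supply the missing elements.\<close>

lemma line_element:
  assumes L: "line x y z w"
    and p: "p \<in> \<Omega>" "p \<noteq> x" "p \<noteq> y" "p \<noteq> z" "col x y p" "\<not> col x z p"
  obtains g p' where "g \<in> stabiliser move_group x" "g z = z" "g p = p'" "line x y p p'"
proof -
  \<comment> \<open>In order of application, \<open>x\<close> goes to \<open>y\<close>,
    \<open>z\<close>, \<open>x\<close>; \<open>z\<close> goes to \<open>w\<close>, \<open>x\<close>,
    \<open>z\<close>; and \<open>p\<close> goes to p', which the last two moves fix.\<close>
  define g where "g = move z x \<circ> move y z \<circ> move x y"
  define p' where "p' = move x y p"
  note n = line_neq[OF L] and pts = line_in_points[OF L]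
  have l: "line x y p p'" using col_line_move[OF p(5)] by (simp add: p'_def)
  note n' = line_neq[OF l] and pts' = line_in_points[OF l]
  have "col x p p'" using line_imp_col(3)[OF l] .
  then have "p' \<noteq> z" using p(6) col_swap(2) by blast
  have "col x z y" using line_imp_col(1)[OF L] col_swap(2) by blast
  then have xzp': "\<not> col x z p'"
    using line_one_or_all[OF l \<open>z \<in> \<Omega>\<close>] n p(4,6) \<open>p' \<noteq> z\<close> by blast
  have "distinct [x, y, z, p']" using n n' \<open>p' \<noteq> z\<close> by simp
  then have yzp': "\<not> col y z p'"
    using col_parity[OF _ pts(1-3) pts'(4)] xzp' line_imp_col(1)[OF L] line_imp_col(2)[OF l]
    by blast
  have "\<not> col z x p'" using xzp' col_swap(1) by blast
  then have "move y z p' = p'" "move z x p' = p'"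
    using yzp' n' \<open>p' \<noteq> z\<close> by (auto intro!: move_noncollinear)
  then have "g p = p'" by (simp add: g_def flip: p'_def)
  moreover have "line y z w x" using L by (rule line_perms) auto
  then have "move x y z = w" "move y z w = x" using L move_line by blast+
  then have "g z = z" by (simp add: g_def)
  moreover have "g \<in> move_group"
    unfolding g_def using pts by (intro move_group_comp move_in_move_group)
  then have "g \<in> stabiliser move_group x" by (simp add: g_def stabiliser_def)
  ultimately show ?thesis using l that by blast
qed

section \<open>Blocks of imprimitivity of a point stabiliser\<close>

lemma automorphism_col:
  assumes "automorphism g"
  shows "col a b c \<Longrightarrow> col (g a) (g b) (g c)"
  using assms unfolding automorphism_def col_def by blast

context
  fixes x :: 'a and Y :: "'a set"
  assumes x: "x \<in> \<Omega>"
    and Y: "Y \<subseteq> \<Omega> - {x}"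
    and block: "\<And>h. h \<in> stabiliser move_group x \<Longrightarrow> h ` Y = Y \<or> h ` Y \<inter> Y = {}"
begin

text \<open>The move [p, z] fixes \<open>x\<close> and takes \<open>p\<close> out of
  \<open>Y\<close>, so it displaces every point of \<open>Y\<close>. Thus \<open>p\<close>,
  \<open>q\<close>, \<open>z\<close> are collinear, and parity on x, p, q, z gives the
  equivalence.\<close>

lemma block_separation:
  assumes p: "p \<in> Y" and q: "q \<in> Y" "q \<noteq> p" and z: "z \<in> \<Omega>" "z \<noteq> x" "z \<notin> Y" "\<not> col x p z"
  shows "col x q z \<longleftrightarrow> \<not> col x p q"
proof -
  have "p \<noteq> z" "q \<noteq> z" using p q z by auto
  have pts: "p \<in> \<Omega>" "q \<in> \<Omega>" "p \<noteq> x" "q \<noteq> x" using p q Y by auto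
  have "move p z \<in> stabiliser move_group x"
    using move_in_stabiliser pts z by metis
  moreover have "move p z ` Y \<noteq> Y" using p z(3) by (metis imageI move_left)
  ultimately have "move p z ` Y \<inter> Y = {}" using block by blast
  then have "move p z q \<noteq> q" using q by (metis disjoint_iff imageI)
  then have "col p z q" using move_moves_iff[OF \<open>p \<noteq> z\<close>] q \<open>q \<noteq> z\<close> by blast
  then have "col p q z" using col_swap(2) by blast
  then show ?thesis
    using col_parity[of x p q z] pts q z x \<open>p \<noteq> z\<close> \<open>q \<noteq> z\<close> by simp
qed

text \<open>If \<open>r\<close> were outside \<open>Y\<close>, a non-neighbour \<open>t\<close> of
  \<open>r\<close> would be adjacent to exactly one of \<open>p\<close>, \<open>q\<close>. Then
  \<open>block_separation\<close> fails for \<open>t\<close> outside \<open>Y\<close> (separated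
  from the point not adjacent to it) and for \<open>t\<close> in \<open>Y\<close> (separated from
  \<open>r\<close>).\<close>

lemma block_closed_under_lines:
  assumes p: "p \<in> Y" and q: "q \<in> Y" and L: "line x p q r"
  shows "r \<in> Y"
proof (rule ccontr)
  assume r: "r \<notin> Y"
  note n = line_neq[OF L] and pts = line_in_points[OF L]
  obtain t where t: "t \<in> \<Omega>" "t \<noteq> x" "t \<noteq> r" "\<not> col x r t"
    using exists_noncollinear[OF x \<open>r \<in> \<Omega>\<close> \<open>x \<noteq> r\<close>] by metis
  have "col x r p" "col x r q" using line_imp_col(2,3)[OF L] col_swap(2) by blast+
  then have t_off: "t \<noteq> p" "t \<noteq> q" using t(4) by blast+
  have no: False if L: "line x p q r" and pq: "p \<in> Y" "q \<in> Y" "col x t p" "\<not> col x t q"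
    and t_off: "t \<noteq> p" "t \<noteq> q" for p q
  proof (cases "t \<in> Y")
    case False
    have "\<not> col x q t" using pq(4) col_swap(2) by blast
    then have "col x p t \<longleftrightarrow> \<not> col x q p"
      using block_separation[OF pq(2,1) _ t(1,2) False] line_neq(4)[OF L] by blast
    then show False using pq line_imp_col(1)[OF L] col_swap(2) by blast
  next
    case True
    have "\<not> col x t r" using t(4) col_swap(2) by blast
    then have "col x p r \<longleftrightarrow> \<not> col x t p"
      using block_separation[OF True pq(1) _ \<open>r \<in> \<Omega>\<close> _ r] t_off \<open>x \<noteq> r\<close> by blast
    then show False using pq(3) line_imp_col(2)[OF L] by blast
  qed
  have "\<not> (col x t p \<longleftrightarrow> col x t q)"
    using line_one_or_all[OF L t(1)] t t_off col_swap(2) by blast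
  moreover have "line x q p r" using L by (rule line_swap)
  ultimately show False using no[OF L] no[of q p] p q t_off by blast
qed

text \<open>If \<open>z\<close> were not adjacent to \<open>p\<close>, separation would make it
  non-adjacent to all three points of a line through \<open>x\<close> inside \<open>Y\<close>,
  against the one-or-all rule.\<close>

lemma block_outside_adjacent:
  assumes p: "p \<in> Y" and q: "q \<in> Y" "col x p q" and z: "z \<in> \<Omega>" "z \<noteq> x" "z \<notin> Y"
  shows "col x p z"
proof (rule ccontr)
  assume pz: "\<not> col x p z"
  obtain r where L: "line x p q r" using q(2) by (auto simp: col_def)
  note n = line_neq[OF L]
  have r: "r \<in> Y" using block_closed_under_lines[OF p q(1) L] .
  have "\<not> col x q z" "\<not> col x r z"
    using block_separation[OF p _ _ z pz] q r n line_imp_col[OF L] by blast+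
  moreover have "z \<noteq> p" "z \<noteq> q" "z \<noteq> r" using p q r z by auto
  ultimately show False using line_one_or_all[OF L z(1,2)] pz col_swap(2) by blast
qed

text \<open>By transitivity every point of \<open>Y\<close> has a neighbour in \<open>Y\<close>,
  hence is adjacent to everything outside \<open>Y\<close>; so \<open>Y\<close> is closed under
  non-adjacency.\<close>

lemma block_with_adjacent_pair:
  assumes p: "p \<in> Y" and q: "q \<in> Y" "col x p q"
  shows "Y = \<Omega> - {x}"
proof (rule noncollinear_connected[OF x Y])
  show "Y \<noteq> {}" using p by blast
  fix y z assume y: "y \<in> Y" and z: "z \<in> \<Omega>" "z \<noteq> x" "\<not> col x y z"
  have "p \<in> \<Omega>" "p \<noteq> x" "y \<in> \<Omega>" "y \<noteq> x" using p y Y by auto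
  then obtain h where h: "h \<in> stabiliser move_group x" "h p = y"
    using stabiliser_orbit[OF x] by metis
  then have "h ` Y = Y" using block[OF h(1)] p y by blast
  then have "h q \<in> Y" using q by blast
  moreover have "col (h x) (h p) (h q)"
    using automorphism_col[OF automorphism_move_group] h(1) q(2) unfolding stabiliser_def by blast
  then have "col x y (h q)" using h by (simp add: stabiliser_def)
  ultimately show "z \<in> Y" using block_outside_adjacent[OF y] z by blast
qed

lemma coclique_block:
  assumes coclique: "\<And>p q. p \<in> Y \<Longrightarrow> q \<in> Y \<Longrightarrow> \<not> col x p q"
    and pq: "p \<in> Y" "q \<in> Y" "p \<noteq> q"
  shows "Y = \<Omega> - {x}"
proof -
  \<comment> \<open>On a line {x, p, w, v}, the point \<open>q\<close> is not adjacent to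
    \<open>p\<close>, hence is adjacent to exactly one of \<open>w\<close>,
    \<open>v\<close>.\<close>
  have isolated: "\<not> col x p w" if pq: "p \<in> Y" "q \<in> Y" "p \<noteq> q" for p q w
  proof
    assume "col x p w"
    then obtain v where L: "line x p w v" by (auto simp: col_def)
    have ptsq: "q \<in> \<Omega>" "q \<noteq> x" using pq Y by auto
    have off: "q \<noteq> w" "q \<noteq> v" using coclique[OF pq(1,2)] line_imp_col[OF L] by blast+
    have no: False if L: "line x p w v" and c: "col x q w" and "q \<noteq> w" for w v
    proof -
      have L': "line x w p v" using L by (rule line_swap)
      have c': "col x w q" using c col_swap(2) by blast
      \<comment> \<open>\<open>line_element\<close> is used with \<open>p\<close> as the fixed
        point: \<open>g\<close> fixes \<open>p\<close> and so preserves \<open>Y\<close>, but sends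
        \<open>q\<close> to a neighbour of \<open>q\<close>.\<close>
      obtain g q' where g: "g \<in> stabiliser move_group x" "g p = p" "g q = q'" "line x w q q'"
        using line_element[OF L' ptsq \<open>q \<noteq> w\<close> _ c'] pq coclique by metis
      have "g ` Y = Y" using block[OF g(1)] g(2) pq(1) by (metis disjoint_iff imageI)
      then have "q' \<in> Y" using g(3) pq(2) by blast
      moreover have "col x q q'" using line_imp_col[OF g(4)] by blast
      ultimately show False using coclique pq(2) by blast
    qed
    have "line x p v w" using L by (rule line_swap)
    then have "\<not> col x q w" "\<not> col x q v" using no L off by blast+
    then show False
      using line_one_or_all[OF L ptsq] pq(3) off coclique[OF pq(2,1)] by blast
  qed
  have "z \<in> Y" if z: "z \<in> \<Omega>" "z \<noteq> x" for z
  proof (rule ccontr)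
    assume "z \<notin> Y"
    then have "col x q z"
      using block_separation[OF pq(1,2) _ z] isolated[OF pq] pq by blast
    then show False using isolated[of q p] pq by blast
  qed
  then show ?thesis using Y by blast
qed

end

section \<open>Primitivity, centre and conjugacy of the moves\<close>

lemma stabiliser_primitive:
  assumes x: "x \<in> \<Omega>"
  shows "primitive_on (stabiliser move_group x) (\<Omega> - {x})"
  unfolding primitive_on_def
proof (intro conjI allI impI)
  show "transitive_on (stabiliser move_group x) (\<Omega> - {x})"
    unfolding transitive_on_def using stabiliser_orbit[OF x] three_points[OF x] by blast
next
  fix Y
  assume "Y \<subseteq> \<Omega> - {x} \<and> Y \<noteq> {} \<and>
    (\<forall>h\<in>stabiliser move_group x. h ` Y = Y \<or> h ` Y \<inter> Y = {})"
  then have Y: "Y \<subseteq> \<Omega> - {x}" "Y \<noteq> {}"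
    and block: "\<And>h. h \<in> stabiliser move_group x \<Longrightarrow> h ` Y = Y \<or> h ` Y \<inter> Y = {}" by blast+
  show "card Y = 1 \<or> Y = \<Omega> - {x}"
  proof (cases "card Y = 1")
    case False
    obtain p where "p \<in> Y" using Y by blast
    moreover have "Y \<noteq> {p}" using False by auto
    ultimately obtain q where "q \<in> Y" "p \<noteq> q" by blast
    then show ?thesis
      using block_with_adjacent_pair[OF x Y(1) block] coclique_block[OF x Y(1) block] \<open>p \<in> Y\<close>
      by metis
  qed simp
qed

lemma move_group_two_primitive:
  assumes "\<Omega> \<noteq> {}"
  shows "two_primitive move_group \<Omega>"
  unfolding two_primitive_def transitive_on_def
  using assms stabiliser_primitive move_in_move_group move_left by metis

text \<open>If a central \<open>c\<close> displaced \<open>x\<close>, the stabiliser of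
  \<open>x\<close> would fix \<open>c x\<close>; but it is transitive on the at least two points
  other than \<open>x\<close>.\<close>

lemma move_group_centre: "centre move_group = {id}"
proof -
  have "c = id" if c: "c \<in> move_group" "\<And>g. g \<in> move_group \<Longrightarrow> c \<circ> g = g \<circ> c" for c
  proof (rule ccontr)
    assume "c \<noteq> id"
    then obtain x where "c x \<noteq> x" by (auto simp: fun_eq_iff)
    have cp: "c permutes \<Omega>" using c(1) move_group_permutes by blast
    have x: "x \<in> \<Omega>" using \<open>c x \<noteq> x\<close> permutes_not_in[OF cp] by blast
    have cx: "c x \<in> \<Omega>" using x permutes_in_image[OF cp] by blast
    obtain z where z: "z \<in> \<Omega>" "z \<noteq> x" "z \<noteq> c x"
      using exists_noncollinear[OF x cx] \<open>c x \<noteq> x\<close> by metis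
    obtain h where h: "h \<in> stabiliser move_group x" "h (c x) = z"
      using stabiliser_orbit[OF x cx _ z(1,2)] \<open>c x \<noteq> x\<close> by blast
    then have "h (c x) = c (h x)" using c(2)[of h] by (metis (mono_tags, lifting) comp_apply mem_Collect_eq stabiliser_def)
    then have "h (c x) = c x" using h(1) by (simp add: stabiliser_def)
    then show False using h z by simp
  qed
  moreover have "id \<in> centre move_group" by (simp add: centre_def move_group_id)
  ultimately show ?thesis by (auto simp: centre_def)
qed

text \<open>To carry \<open>a\<close>, \<open>b\<close> to \<open>c\<close>, \<open>d\<close>, first
  apply [a, c], then an element of the stabiliser of \<open>c\<close>.\<close>

lemma moves_conj_class:
  assumes ab: "a \<in> \<Omega>" "b \<in> \<Omega>" "a \<noteq> b"
  shows "moves = conj_class move_group (move a b)"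
proof
  show "moves \<subseteq> conj_class move_group (move a b)"
  proof
    fix e assume "e \<in> moves"
    then obtain c d where e: "e = move c d" "c \<in> \<Omega>" "d \<in> \<Omega>" "c \<noteq> d" by (rule moves_cases)
    let ?k = "move a c"
    have kb: "?k b \<in> \<Omega>" "?k b \<noteq> c"
      using ab e permutes_in_image[OF move_permutes[of a c]] by (auto, metis move_left move_move)
    obtain h where h: "h \<in> stabiliser move_group c" "h (?k b) = d"
      using stabiliser_orbit[OF e(2) kb e(3)] e(4) by blast
    define g where "g = h \<circ> ?k"
    have g: "g \<in> move_group"
      using h(1) ab(1) e(2) unfolding g_def stabiliser_def
      by (intro move_group_comp move_in_move_group) auto
    have "g a = c" "g b = d" using h by (auto simp: g_def stabiliser_def)
    then have "g \<circ> move a b \<circ> inv g = e"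
      using automorphism_conj[OF automorphism_move_group[OF g]] e(1) by simp
    then show "e \<in> conj_class move_group (move a b)" using g by (auto simp: conj_class_def)
  qed
  show "conj_class move_group (move a b) \<subseteq> moves"
  proof
    fix e assume "e \<in> conj_class move_group (move a b)"
    then obtain g where "g \<in> move_group" "e = g \<circ> move a b \<circ> inv g"
      by (auto simp: conj_class_def)
    moreover have "move a b \<in> moves" using ab move_in_moves by blast
    ultimately show "e \<in> moves"
      using move_group_three_transposition unfolding three_transposition_group_def by metis
  qed
qed

end

theorem corollary4p7:
  fixes \<Omega> :: "'a set" and \<B> :: "'a set multiset" and n lam :: nat and pinf :: 'a
  assumes "design_2_4 \<Omega> \<B> n lam"
    and "supersimple \<B>"
    and "prop_triangle \<B>"
    and "regular_two_graph \<Omega> (collinear_triples \<Omega> \<B>)"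
    and "n > 2 * lam + 2"
    and "pinf \<in> \<Omega>"
  shows "three_transposition_group (L_infty \<Omega> \<B> pinf) {mv \<B> a b | a b. a \<in> \<Omega> \<and> b \<in> \<Omega> \<and> a \<noteq> b}
       \<and> is_subgroup_Sym \<Omega> (L_infty \<Omega> \<B> pinf) \<and> two_primitive (L_infty \<Omega> \<B> pinf) \<Omega>
       \<and> centre (L_infty \<Omega> \<B> pinf) = {id}
       \<and> (\<exists>e\<in>L_infty \<Omega> \<B> pinf. {mv \<B> a b | a b. a \<in> \<Omega> \<and> b \<in> \<Omega> \<and> a \<noteq> b} = conj_class (L_infty \<Omega> \<B> pinf) e)"
proof -
  interpret two_graph_design \<Omega> \<B> n lam
    using assms by unfold_locales
  obtain b where b: "b \<in> \<Omega>" "b \<noteq> pinf" using three_points[OF assms(6)] by metis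
  have "\<exists>e\<in>move_group. moves = conj_class move_group e"
    using moves_conj_class[of pinf b] move_in_move_group[of pinf b] assms(6) b by metis
  moreover have "\<Omega> \<noteq> {}" using assms(6) by blast
  ultimately show ?thesis
    unfolding L_infty_eq_move_group[OF assms(6)] moves_def[symmetric]
    using move_group_three_transposition move_group_subgroup move_group_two_primitive
      move_group_centre by blast
qed

end
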